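(* Let $\mathcal{L}$ be a finite join-semidistributive lattice with at least two atoms and at least two coatoms, and let $\mathcal{M}$ be a maximal sublattice of $\mathcal{L}$. If the complement $\mathcal{C}=\mathcal{L}\setminus\mathcal{M}$ has a greatest element, then $\mathcal{C}$ is an interval of $\mathcal{L}$. Dually, let $\mathcal{L}$ be a finite meet-semidistributive lattice with at least two atoms and at least two coatoms, and let $\mathcal{M}$ be a maximal sublattice of $\mathcal{L}$. If $\mathcal{C}=\mathcal{L}\setminus\mathcal{M}$ has a least element, then $\mathcal{C}$ is an interval of $\mathcal{L}$.
   Context: A lattice is join-semidistributive if $x\vee y=x\vee z$ implies $x\vee(y\wedge z)=x\vee y$ for all $x,y,z$; meet-semidistributive is the dual condition. A maximal sublattice is a proper (nonempty) sublattice not contained in any other proper sublattice. An interval is a set of the form $[a,b]=\{c: a\le c\le b\}$. Atoms are the covers of the least element, coatoms the subcovers of the greatest element. *)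

theory Defs
  imports Main
begin

class join_semidistributive_lattice = lattice +
  assumes join_semidistrib: "sup x y = sup x z \<Longrightarrow> sup x (inf y z) = sup x y"

class meet_semidistributive_lattice = lattice +
  assumes meet_semidistrib: "inf x y = inf x z \<Longrightarrow> inf x (sup y z) = inf x y"

definition covered_by :: "'a::order \<Rightarrow> 'a \<Rightarrow> bool" where
  "covered_by x y \<longleftrightarrow> x < y \<and> \<not> (\<exists>z. x < z \<and> z < y)"

text \<open>
  The bounds of a finite lattice are described order-theoretically, so that no
  \<open>bot\<close> or \<open>top\<close> has to be supplied by the type class.
\<close>

definition is_least :: "'a::order set \<Rightarrow> 'a \<Rightarrow> bool" where
  "is_least A a \<longleftrightarrow> a \<in> A \<and> (\<forall>x\<in>A. a \<le> x)"

definition is_greatest :: "'a::order set \<Rightarrow> 'a \<Rightarrow> bool" where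
  "is_greatest A a \<longleftrightarrow> a \<in> A \<and> (\<forall>x\<in>A. x \<le> a)"

definition atom :: "'a::order \<Rightarrow> bool" where
  "atom a \<longleftrightarrow> (\<exists>b. is_least UNIV b \<and> covered_by b a)"

definition coatom :: "'a::order \<Rightarrow> bool" where
  "coatom a \<longleftrightarrow> (\<exists>t. is_greatest UNIV t \<and> covered_by a t)"

definition sublattice :: "'a::lattice set \<Rightarrow> bool" where
  "sublattice S \<longleftrightarrow> S \<noteq> {} \<and> (\<forall>x\<in>S. \<forall>y\<in>S. sup x y \<in> S \<and> inf x y \<in> S)"

definition maximal_sublattice :: "'a::lattice set \<Rightarrow> bool" where
  "maximal_sublattice M \<longleftrightarrow>
     sublattice M \<and> M \<noteq> UNIV \<and>
     (\<forall>N. sublattice N \<longrightarrow> N \<noteq> UNIV \<longrightarrow> M \<subseteq> N \<longrightarrow> N = M)"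

definition order_interval :: "'a::order set \<Rightarrow> bool" where
  "order_interval A \<longleftrightarrow> (\<exists>a b. a \<le> b \<and> A = {a..b})"

end

theory Submission
  imports Defs
begin

text \<open>
  Let \<open>g\<close> be the greatest element of the complement \<open>C\<close> of \<open>M\<close>, and let \<open>m\<close> be the greatest
  element of \<open>M\<close> below \<open>g\<close> (if there is none, \<open>C\<close> is the whole down-set of \<open>g\<close>). For \<open>c\<close> in \<open>C\<close>
  the union of \<open>M\<close> and the down-set of \<open>m \<squnion> c\<close> is a sublattice, because everything not below \<open>g\<close>
  lies in \<open>M\<close>. By maximality it contains \<open>g\<close>, so \<open>m \<squnion> c = g\<close>. Hence \<open>C\<close> consists of the elements
  \<open>c \<le> g\<close> with \<open>m \<squnion> c = g\<close>, a set that join-semidistributivity closes under meets.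
\<close>

lemma (in semilattice_inf) finite_inf_closed_has_least:
  assumes "finite A" "A \<noteq> {}" and closed: "\<And>x y. x \<in> A \<Longrightarrow> y \<in> A \<Longrightarrow> inf x y \<in> A"
  shows "\<exists>s\<in>A. \<forall>a\<in>A. s \<le> a"
proof -
  \<comment> \<open>Removing a point from \<open>A\<close> may destroy closure under
    \<open>inf\<close>, so the induction runs over all nonempty \<open>B\<close> inside
    \<open>A\<close> and asks only for a lower bound of \<open>B\<close> that lies in
    \<open>A\<close>. For \<open>B = A\<close> this bound is a least element.\<close>
  have "\<exists>s\<in>A. \<forall>b\<in>B. s \<le> b" if "finite B" "B \<noteq> {}" "B \<subseteq> A" for B
    using that
  proof (induction B rule: finite_ne_induct)
    case (singleton x)
    then show ?case by auto
  next
    case (insert x F)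
    then obtain s where "s \<in> A" "\<forall>b\<in>F. s \<le> b" by auto
    with insert.prems show ?case
      by (intro bexI[of _ "inf x s"]) (auto intro: closed le_infI2)
  qed
  then show ?thesis using assms(1,2) by blast
qed

lemma (in semilattice_sup) finite_sup_closed_has_greatest:
  assumes "finite A" "A \<noteq> {}" "\<And>x y. x \<in> A \<Longrightarrow> y \<in> A \<Longrightarrow> sup x y \<in> A"
  shows "\<exists>s\<in>A. \<forall>a\<in>A. a \<le> s"
  by (rule semilattice_inf.finite_inf_closed_has_least[OF dual_semilattice]) (fact assms)+

text \<open>Stated for the lattice locale, so that the dual lattice can be substituted for the given one.\<close>

lemma (in lattice) complement_of_maximal_closed_subset:
  assumes fin: "finite (UNIV :: 'a set)"
    and jsd: "\<And>x y z. sup x y = sup x z \<Longrightarrow> sup x (inf y z) = sup x y"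
    and closed: "\<And>x y. x \<in> M \<Longrightarrow> y \<in> M \<Longrightarrow> sup x y \<in> M \<and> inf x y \<in> M"
    and maximal: "\<And>S. \<lbrakk>\<And>x y. x \<in> S \<Longrightarrow> y \<in> S \<Longrightarrow> sup x y \<in> S \<and> inf x y \<in> S; M \<subseteq> S\<rbrakk>
      \<Longrightarrow> S = M \<or> S = UNIV"
    and g: "g \<notin> M" "\<And>x. x \<notin> M \<Longrightarrow> x \<le> g"
  shows "\<exists>p\<le>g. \<forall>x. x \<notin> M \<longleftrightarrow> p \<le> x \<and> x \<le> g"
proof (cases "\<exists>x\<in>M. x \<le> g")
  case False
  obtain b where "\<forall>x. b \<le> x"
    using finite_inf_closed_has_least[OF fin] by auto
  then have "\<forall>x. x \<notin> M \<longleftrightarrow> b \<le> x \<and> x \<le> g" using False g(2) by blast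
  then show ?thesis using \<open>\<forall>x. b \<le> x\<close> by blast
next
  case True
  let ?D = "{x \<in> M. x \<le> g}"
  have "finite ?D" using finite_subset[OF subset_UNIV fin] .
  moreover have "?D \<noteq> {}" using True by blast
  moreover have "sup x y \<in> ?D" if "x \<in> ?D" "y \<in> ?D" for x y
    using that closed by auto
  ultimately have "\<exists>m\<in>?D. \<forall>x\<in>?D. x \<le> m"
    by (rule finite_sup_closed_has_greatest)
  then obtain m where m: "m \<in> M" "m \<le> g" and m_greatest: "\<And>x. x \<in> M \<Longrightarrow> x \<le> g \<Longrightarrow> x \<le> m"
    by auto
  have sup_m: "sup m c = g" if c: "c \<notin> M" for c
  proof -
    let ?S = "M \<union> {x. x \<le> sup m c}"
    \<comment> \<open>If \<open>x \<le> g\<close>, then \<open>x \<le> m\<close>, so the join stays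
      below \<open>sup m c\<close>. Otherwise the join is not below \<open>g\<close> and hence lies
      in \<open>M\<close>.\<close>
    have sup_mixed: "sup x y \<in> ?S" if "x \<in> M" "y \<le> sup m c" for x y
    proof (cases "x \<le> g")
      case True
      then show ?thesis using that m_greatest[of x] le_supI1 by simp
    next
      case False
      then show ?thesis using g(2)[of "sup x y"] by auto
    qed
    have "sup x y \<in> ?S \<and> inf x y \<in> ?S" if xy: "x \<in> ?S" "y \<in> ?S" for x y
    proof -
      consider "x \<in> M" "y \<in> M" | "x \<in> M" "y \<le> sup m c" | "y \<in> M" "x \<le> sup m c"
        | "x \<le> sup m c" "y \<le> sup m c"
        using xy by blast
      then show ?thesis
      proof cases
        case 1
        then show ?thesis using closed by simp
      next
        case 2
        then show ?thesis using sup_mixed le_infI2 by simp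
      next
        case 3
        then show ?thesis using sup_mixed[of y x] le_infI1 sup_commute[of x y] by simp
      next
        case 4
        then show ?thesis by (simp add: le_infI1)
      qed
    qed
    then have "?S = M \<or> ?S = UNIV" by (rule maximal[OF _ Un_upper1])
    moreover have "c \<in> ?S" by simp
    ultimately have "g \<in> ?S" using c by blast
    then have "g \<le> sup m c" using g(1) by simp
    moreover have "sup m c \<le> g" using g(2)[OF c] m(2) by simp
    ultimately show ?thesis by (rule order.antisym[rotated])
  qed
  let ?C = "{c. sup m c = g}"
  \<comment> \<open>Conversely to \<open>sup_m\<close>, an \<open>x\<close> in \<open>M\<close> with
    \<open>sup m x = g\<close> would force \<open>g\<close> into \<open>M\<close> by
    closure.\<close>
  have C: "x \<notin> M \<longleftrightarrow> x \<in> ?C" for x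
    using sup_m[of x] closed[OF m(1), of x] g(1) by auto
  have "finite ?C" using finite_subset[OF subset_UNIV fin] .
  moreover have "g \<in> ?C" using C g(1) by blast
  moreover have "inf x y \<in> ?C" if "x \<in> ?C" "y \<in> ?C" for x y
    using that jsd[of m x y] by auto
  ultimately obtain p where p: "p \<in> ?C" "\<forall>c\<in>?C. p \<le> c"
    using finite_inf_closed_has_least[of ?C] by blast
  \<comment> \<open>Nothing between \<open>p\<close> and \<open>g\<close> is missed: joining with
    \<open>m\<close> is monotone, so \<open>sup m x\<close> is squeezed between
    \<open>sup m p = g\<close> and \<open>g\<close>.\<close>
  have "x \<in> ?C" if "p \<le> x" "x \<le> g" for x
  proof -
    have "g \<le> sup m x" using p(1) sup_mono[OF order.refl that(1), of m] by simp
    moreover have "sup m x \<le> g" using m(2) that(2) by simp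
    ultimately show ?thesis using order.antisym by simp
  qed
  then have "\<forall>x. x \<notin> M \<longleftrightarrow> p \<le> x \<and> x \<le> g" using p(2) C g(2) by blast
  moreover have "p \<le> g" using p(2) \<open>g \<in> ?C\<close> by blast
  ultimately show ?thesis by blast
qed

text \<open>Bare closure under both operations, unlike the class constant \<open>sublattice\<close>,
  can also be read in the dual lattice. The set \<open>S\<close> is nonempty because it contains
  \<open>M\<close>.\<close>

lemma maximal_sublatticeD:
  assumes "maximal_sublattice M"
  shows "x \<in> M \<Longrightarrow> y \<in> M \<Longrightarrow> sup x y \<in> M \<and> inf x y \<in> M"
    and "\<lbrakk>\<And>x y. x \<in> S \<Longrightarrow> y \<in> S \<Longrightarrow> sup x y \<in> S \<and> inf x y \<in> S; M \<subseteq> S\<rbrakk> \<Longrightarrow> S = M \<or> S = UNIV"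
proof -
  have M: "sublattice M" "\<And>S. sublattice S \<Longrightarrow> S \<noteq> UNIV \<Longrightarrow> M \<subseteq> S \<Longrightarrow> S = M"
    using assms unfolding maximal_sublattice_def by simp_all
  show "x \<in> M \<Longrightarrow> y \<in> M \<Longrightarrow> sup x y \<in> M \<and> inf x y \<in> M"
    using M(1) unfolding sublattice_def by simp
  assume S: "\<And>x y. x \<in> S \<Longrightarrow> y \<in> S \<Longrightarrow> sup x y \<in> S \<and> inf x y \<in> S" "M \<subseteq> S"
  have "sublattice S"
    using M(1) S unfolding sublattice_def by auto
  then show "S = M \<or> S = UNIV" using M(2) S(2) by blast
qed

lemma order_interval_complement_if_greatest:
  fixes M :: "'a::{finite, join_semidistributive_lattice} set"
  assumes M: "maximal_sublattice M" and g: "is_greatest (- M) g"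
  shows "order_interval (- M)"
proof -
  have "\<exists>p\<le>g. \<forall>x. x \<notin> M \<longleftrightarrow> p \<le> x \<and> x \<le> g"
  proof (rule complement_of_maximal_closed_subset)
    show "finite (UNIV :: 'a set)" by simp
    show "sup x (inf y z) = sup x y" if "sup x y = sup x z" for x y z :: 'a
      using that by (rule join_semidistrib)
    show "sup x y \<in> M \<and> inf x y \<in> M" if "x \<in> M" "y \<in> M" for x y
      using maximal_sublatticeD(1)[OF M that] by blast
    show "S = M \<or> S = UNIV"
      if "\<And>x y. x \<in> S \<Longrightarrow> y \<in> S \<Longrightarrow> sup x y \<in> S \<and> inf x y \<in> S" "M \<subseteq> S" for S
      by (rule maximal_sublatticeD(2)[OF M _ that(2)]) (simp add: that(1))
  qed (use g in \<open>auto simp: is_greatest_def\<close>)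
  then show ?thesis
    unfolding order_interval_def by (auto simp: set_eq_iff)
qed

text \<open>Reversing the order exchanges \<open>sup\<close> and \<open>inf\<close>:
  meet-semidistributivity becomes join-semidistributivity, \<open>l\<close> becomes the greatest
  element of the complement, and the sublattices stay the same.\<close>

lemma order_interval_complement_if_least:
  fixes N :: "'a::{finite, meet_semidistributive_lattice} set"
  assumes N: "maximal_sublattice N" and l: "is_least (- N) l"
  shows "order_interval (- N)"
proof -
  have "\<exists>p\<ge>l. \<forall>x. x \<notin> N \<longleftrightarrow> x \<le> p \<and> l \<le> x"
  proof (rule lattice.complement_of_maximal_closed_subset[OF dual_lattice])
    show "finite (UNIV :: 'a set)" by simp
    show "inf x (sup y z) = inf x y" if "inf x y = inf x z" for x y z :: 'a
      using that by (rule meet_semidistrib)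
    show "inf x y \<in> N \<and> sup x y \<in> N" if "x \<in> N" "y \<in> N" for x y
      using maximal_sublatticeD(1)[OF N that] by blast
    show "S = N \<or> S = UNIV"
      if "\<And>x y. x \<in> S \<Longrightarrow> y \<in> S \<Longrightarrow> inf x y \<in> S \<and> sup x y \<in> S" "N \<subseteq> S" for S
      by (rule maximal_sublatticeD(2)[OF N _ that(2)]) (simp add: that(1))
  qed (use l in \<open>auto simp: is_least_def\<close>)
  then show ?thesis
    unfolding order_interval_def by (auto simp: set_eq_iff)
qed

theorem theorem4p5:
  fixes M :: "'a::{finite, join_semidistributive_lattice} set"
    and N :: "'b::{finite, meet_semidistributive_lattice} set"
  shows "(card {x::'a. atom x} \<ge> 2 \<longrightarrow> card {x::'a. coatom x} \<ge> 2 \<longrightarrow>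
            maximal_sublattice M \<longrightarrow> (\<exists>g. is_greatest (- M) g) \<longrightarrow>
            order_interval (- M))
       \<and> (card {x::'b. atom x} \<ge> 2 \<longrightarrow> card {x::'b. coatom x} \<ge> 2 \<longrightarrow>
            maximal_sublattice N \<longrightarrow> (\<exists>l. is_least (- N) l) \<longrightarrow>
            order_interval (- N))"
  using order_interval_complement_if_greatest order_interval_complement_if_least by blast

end
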